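(* Let $\mathcal{C}$ be a category, let $(\mathcal{E}, \mathcal{M})$ be an orthogonal factorisation system on $\mathcal{C}$, and let $(M, \iota)$ be an idempotent comonad on $\mathcal{C}$. Let $T$ and $\nu$ be the data constructed from these in the context. Then the pair $(T, \nu)$ is a semi-monad on $\mathcal{C}^{\mathbf{2}}$.
   Context: Orthogonal factorisation system: two classes $\mathcal{E}, \mathcal{M}$ of morphisms of $\mathcal{C}$, both containing the isomorphisms and closed under composition, such that every morphism factors as $m \circ e$ with $e \in \mathcal{E}$, $m \in \mathcal{M}$, and such that for every commutative square $m \circ f = g \circ e$ with $e \in \mathcal{E}$, $m \in \mathcal{M}$ there is a unique $h$ with $h \circ e = f$ and $m \circ h = g$. A choice of $(\mathcal{E},\mathcal{M})$-factorisations is fixed. $(M,\iota)$ denotes an idempotent comonad with counit $\iota \colon M \Rightarrow 1$, so that each $M\iota_A$ is invertible. $\mathcal{C}^{\mathbf{2}}$ is the arrow category: objects are morphisms of $\mathcal{C}$; a morphism $\langle h, k\rangle \colon f \to g$, for $f \colon A \to B$ and $g \colon C \to D$, is a pair $h \colon A \to C$, $k \colon B \to D$ with $k \circ f = g \circ h$. A semi-monad on a category is an endofunctor $T$ with a natural transformation $\nu \colon T^2 \Rightarrow T$ that is associative, $\nu \cdot T\nu = \nu \cdot \nu T$ (a monad without a unit). Construction of $T$ and $\nu$. For $f \colon A \to B$, let $f \circ \iota_A = Tf \circ Sf$ be the chosen factorisation, with $Sf \colon MA \to Jf$ in $\mathcal{E}$ and $Tf \colon Jf \to B$ in $\mathcal{M}$.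 For $\langle h,k \rangle \colon f \to g$, $J\langle h,k\rangle \colon Jf \to Jg$ is the unique morphism with $J\langle h,k\rangle \circ Sf = Sg \circ Mh$ and $Tg \circ J\langle h,k\rangle = k \circ Tf$; set $T\langle h,k\rangle = \langle J\langle h,k\rangle, k\rangle$. Let $\nu_f \colon JTf \to Jf$ be the unique morphism with $\nu_f \circ STf = \iota_{Jf}$ and $Tf \circ \nu_f = T^2 f$; the component of $\nu \colon T^2 \Rightarrow T$ at $f$ is $\langle \nu_f, 1_B\rangle$. *)

theory Defs
  imports Main
begin

record ('o, 'a) category =
  Obj :: "'o set"
  Arr :: "'a set"
  Dom :: "'a \<Rightarrow> 'o"
  Cod :: "'a \<Rightarrow> 'o"
  Id :: "'o \<Rightarrow> 'a"
  Comp :: "'a \<Rightarrow> 'a \<Rightarrow> 'a"  (infixr \<open>\<cdot>\<index>\<close> 70)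

definition hom :: "('o, 'a, 'z) category_scheme \<Rightarrow> 'o \<Rightarrow> 'o \<Rightarrow> 'a set" where
  "hom C A B = {f \<in> Arr C. Dom C f = A \<and> Cod C f = B}"

locale category =
  fixes C :: "('o, 'a) category" (structure)
  assumes Dom_in_Obj: "f \<in> Arr C \<Longrightarrow> Dom C f \<in> Obj C"
    and Cod_in_Obj: "f \<in> Arr C \<Longrightarrow> Cod C f \<in> Obj C"
    and Id_in_hom: "A \<in> Obj C \<Longrightarrow> Id C A \<in> hom C A A"
    and Comp_in_hom: "f \<in> hom C X Y \<Longrightarrow> g \<in> hom C Y Z \<Longrightarrow> g \<cdot> f \<in> hom C X Z"
    and Comp_assoc:
      "f \<in> hom C W X \<Longrightarrow> g \<in> hom C X Y \<Longrightarrow> h \<in> hom C Y Z \<Longrightarrow> (h \<cdot> g) \<cdot> f = h \<cdot> (g \<cdot> f)"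
    and Comp_Id_left: "f \<in> hom C X Y \<Longrightarrow> Id C Y \<cdot> f = f"
    and Comp_Id_right: "f \<in> hom C X Y \<Longrightarrow> f \<cdot> Id C X = f"

definition isomorphism :: "('o, 'a) category \<Rightarrow> 'a \<Rightarrow> bool" where
  "isomorphism C f \<longleftrightarrow> f \<in> Arr C \<and>
    (\<exists>g \<in> hom C (Cod C f) (Dom C f).
       g \<cdot>\<^bsub>C\<^esub> f = Id C (Dom C f) \<and> f \<cdot>\<^bsub>C\<^esub> g = Id C (Cod C f))"

record ('o, 'a, 'p, 'b) functor_data =
  on_obj :: "'o \<Rightarrow> 'p"
  on_arr :: "'a \<Rightarrow> 'b"

locale category_functor = source: category C + target: category D
  for C :: "('o, 'a) category" and D :: "('p, 'b) category" +
  fixes F :: "('o, 'a, 'p, 'b) functor_data"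
  assumes on_obj_in_Obj: "A \<in> Obj C \<Longrightarrow> on_obj F A \<in> Obj D"
    and on_arr_in_hom: "f \<in> hom C X Y \<Longrightarrow> on_arr F f \<in> hom D (on_obj F X) (on_obj F Y)"
    and on_arr_Id: "A \<in> Obj C \<Longrightarrow> on_arr F (Id C A) = Id D (on_obj F A)"
    and on_arr_Comp: "f \<in> hom C X Y \<Longrightarrow> g \<in> hom C Y Z \<Longrightarrow>
      on_arr F (g \<cdot>\<^bsub>C\<^esub> f) = on_arr F g \<cdot>\<^bsub>D\<^esub> on_arr F f"

definition id_functor :: "('o, 'a, 'o, 'a) functor_data" where
  "id_functor = \<lparr>on_obj = (\<lambda>A. A), on_arr = (\<lambda>f. f)\<rparr>"

definition comp_functor ::
    "('p, 'b, 'q, 'c) functor_data \<Rightarrow> ('o, 'a, 'p, 'b) functor_data \<Rightarrow> ('o, 'a, 'q, 'c) functor_data"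
  where
  "comp_functor G F = \<lparr>on_obj = (\<lambda>A. on_obj G (on_obj F A)), on_arr = (\<lambda>f. on_arr G (on_arr F f))\<rparr>"

locale natural_transformation =
  F: category_functor C D F + G: category_functor C D G
  for C :: "('o, 'a) category" and D :: "('p, 'b) category" and F G +
  fixes \<alpha> :: "'o \<Rightarrow> 'b"
  assumes component_in_hom: "A \<in> Obj C \<Longrightarrow> \<alpha> A \<in> hom D (on_obj F A) (on_obj G A)"
    and naturality: "f \<in> hom C X Y \<Longrightarrow> \<alpha> Y \<cdot>\<^bsub>D\<^esub> on_arr F f = on_arr G f \<cdot>\<^bsub>D\<^esub> \<alpha> X"

locale comonad =
  counit: natural_transformation C C M id_functor \<iota> +
  comult: natural_transformation C C M "comp_functor M M" \<delta>
  for C :: "('o, 'a) category" and M \<iota> \<delta> +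
  assumes coassociative: "A \<in> Obj C \<Longrightarrow>
      on_arr M (\<delta> A) \<cdot>\<^bsub>C\<^esub> \<delta> A = \<delta> (on_obj M A) \<cdot>\<^bsub>C\<^esub> \<delta> A"
    and counit_left: "A \<in> Obj C \<Longrightarrow> \<iota> (on_obj M A) \<cdot>\<^bsub>C\<^esub> \<delta> A = Id C (on_obj M A)"
    and counit_right: "A \<in> Obj C \<Longrightarrow> on_arr M (\<iota> A) \<cdot>\<^bsub>C\<^esub> \<delta> A = Id C (on_obj M A)"

text \<open>The comultiplication of an idempotent comonad is determined by the counit, as the inverse
  of \<open>M\<iota>\<close>, and is therefore not part of the data.\<close>

definition idempotent_comonad ::
    "('o, 'a) category \<Rightarrow> ('o, 'a, 'o, 'a) functor_data \<Rightarrow> ('o \<Rightarrow> 'a) \<Rightarrow> bool" where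
  "idempotent_comonad C M \<iota> \<longleftrightarrow>
    (\<exists>\<delta>. comonad C M \<iota> \<delta> \<and> (\<forall>A \<in> Obj C. isomorphism C (\<delta> A)))"

lemma idempotent_comonad_counit_isomorphism:
  assumes "idempotent_comonad C M \<iota>" and A: "A \<in> Obj C"
  shows "isomorphism C (on_arr M (\<iota> A))"
proof -
  obtain \<delta> where "comonad C M \<iota> \<delta>" and iso: "isomorphism C (\<delta> A)"
    using assms by (auto simp: idempotent_comonad_def)
  then interpret comonad C M \<iota> \<delta> by simp
  let ?X = "on_obj M A" and ?Y = "on_obj M (on_obj M A)" and ?m = "on_arr M (\<iota> A)"
  have d: "\<delta> A \<in> hom C ?X ?Y"
    using comult.component_in_hom[OF A] by (simp add: comp_functor_def)
  have m: "?m \<in> hom C ?Y ?X"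
    using counit.F.on_arr_in_hom[OF counit.component_in_hom[OF A]] by (simp add: id_functor_def)
  obtain g where g: "g \<in> hom C ?Y ?X" "\<delta> A \<cdot>\<^bsub>C\<^esub> g = Id C ?Y"
    using iso d unfolding isomorphism_def hom_def by force
  have "?m = ?m \<cdot>\<^bsub>C\<^esub> (\<delta> A \<cdot>\<^bsub>C\<^esub> g)"
    using g m counit.F.source.Comp_Id_right by simp
  also have "\<dots> = (?m \<cdot>\<^bsub>C\<^esub> \<delta> A) \<cdot>\<^bsub>C\<^esub> g"
    using counit.F.source.Comp_assoc[OF g(1) d m] by simp
  also have "\<dots> = g"
    using counit_right[OF A] counit.F.source.Comp_Id_left[OF g(1)] by simp
  finally have "?m = g" .
  then show ?thesis
    using g d m counit_right[OF A] unfolding isomorphism_def hom_def by auto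
qed

locale semi_monad =
  multiplication: natural_transformation C C "comp_functor T T" T \<nu> + endo: category_functor C C T
  for C :: "('o, 'a) category" and T \<nu> +
  assumes associative: "A \<in> Obj C \<Longrightarrow>
      \<nu> A \<cdot>\<^bsub>C\<^esub> on_arr T (\<nu> A) = \<nu> A \<cdot>\<^bsub>C\<^esub> \<nu> (on_obj T A)"

text \<open>A pair \<open>\<langle>h, k\<rangle> : f \<rightarrow> g\<close> does not determine \<open>f\<close> and \<open>g\<close>, so an arrow of the arrow category is
  encoded as the quadruple \<open>(f, h, k, g)\<close>.\<close>

type_synonym 'a square = "'a \<times> 'a \<times> 'a \<times> 'a"

definition arrow_category :: "('o, 'a) category \<Rightarrow> ('a, 'a square) category" where
  "arrow_category C =
    \<lparr>Obj = Arr C,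
     Arr = {(f, h, k, g). f \<in> Arr C \<and> g \<in> Arr C \<and>
              h \<in> hom C (Dom C f) (Dom C g) \<and> k \<in> hom C (Cod C f) (Cod C g) \<and>
              k \<cdot>\<^bsub>C\<^esub> f = g \<cdot>\<^bsub>C\<^esub> h},
     Dom = (\<lambda>(f, h, k, g). f),
     Cod = (\<lambda>(f, h, k, g). g),
     Id = (\<lambda>f. (f, Id C (Dom C f), Id C (Cod C f), f)),
     Comp = (\<lambda>(f', h', k', g') (f, h, k, g). (f, h' \<cdot>\<^bsub>C\<^esub> h, k' \<cdot>\<^bsub>C\<^esub> k, g'))\<rparr>"

locale orthogonal_factorisation_system = category C
  for C :: "('o, 'a) category" (structure) +
  fixes \<E> \<M> :: "'a set"
  assumes E_subset: "\<E> \<subseteq> Arr C"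
    and M_subset: "\<M> \<subseteq> Arr C"
    and iso_in_E: "isomorphism C f \<Longrightarrow> f \<in> \<E>"
    and iso_in_M: "isomorphism C f \<Longrightarrow> f \<in> \<M>"
    and Comp_in_E: "f \<in> \<E> \<Longrightarrow> g \<in> \<E> \<Longrightarrow> Cod C f = Dom C g \<Longrightarrow> g \<cdot> f \<in> \<E>"
    and Comp_in_M: "f \<in> \<M> \<Longrightarrow> g \<in> \<M> \<Longrightarrow> Cod C f = Dom C g \<Longrightarrow> g \<cdot> f \<in> \<M>"
    and factorisation_exists:
      "f \<in> Arr C \<Longrightarrow> \<exists>e \<in> \<E>. \<exists>m \<in> \<M>. Cod C e = Dom C m \<and> m \<cdot> e = f"
    and unique_diagonal:
      "\<lbrakk>e \<in> \<E>; m \<in> \<M>; f \<in> hom C (Dom C e) (Dom C m); g \<in> hom C (Cod C e) (Cod C m);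
        m \<cdot> f = g \<cdot> e\<rbrakk>
       \<Longrightarrow> \<exists>!h. h \<in> hom C (Cod C e) (Dom C m) \<and> h \<cdot> e = f \<and> m \<cdot> h = g"

definition chosen_factorisations ::
    "('o, 'a) category \<Rightarrow> 'a set \<Rightarrow> 'a set \<Rightarrow> ('a \<Rightarrow> 'a) \<Rightarrow> ('a \<Rightarrow> 'a) \<Rightarrow> bool" where
  "chosen_factorisations C \<E> \<M> L R \<longleftrightarrow>
    (\<forall>f \<in> Arr C. L f \<in> \<E> \<and> R f \<in> \<M> \<and> Cod C (L f) = Dom C (R f) \<and> R f \<cdot>\<^bsub>C\<^esub> L f = f)"

text \<open>For \<open>f : A \<rightarrow> B\<close> one has \<open>S_part f : M A \<rightarrow> J_obj f\<close> in \<open>\<E>\<close> and \<open>T_part f : J_obj f \<rightarrow> B\<close> in \<open>\<M>\<close>.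
  The definite descriptions below select diagonals of squares with \<open>S_part\<close> on one side and
  \<open>T_part\<close> on the other, so they are well defined by the unique diagonal property.\<close>

definition S_part :: "('o, 'a) category \<Rightarrow> ('o \<Rightarrow> 'a) \<Rightarrow> ('a \<Rightarrow> 'a) \<Rightarrow> 'a \<Rightarrow> 'a" where
  "S_part C \<iota> L f = L (f \<cdot>\<^bsub>C\<^esub> \<iota> (Dom C f))"

definition T_part :: "('o, 'a) category \<Rightarrow> ('o \<Rightarrow> 'a) \<Rightarrow> ('a \<Rightarrow> 'a) \<Rightarrow> 'a \<Rightarrow> 'a" where
  "T_part C \<iota> R f = R (f \<cdot>\<^bsub>C\<^esub> \<iota> (Dom C f))"

definition J_obj :: "('o, 'a) category \<Rightarrow> ('o \<Rightarrow> 'a) \<Rightarrow> ('a \<Rightarrow> 'a) \<Rightarrow> 'a \<Rightarrow> 'o" where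
  "J_obj C \<iota> L f = Cod C (S_part C \<iota> L f)"

fun J_arr ::
    "('o, 'a) category \<Rightarrow> ('o, 'a, 'o, 'a) functor_data \<Rightarrow> ('o \<Rightarrow> 'a) \<Rightarrow> ('a \<Rightarrow> 'a) \<Rightarrow> ('a \<Rightarrow> 'a) \<Rightarrow>
      'a square \<Rightarrow> 'a" where
  "J_arr C M \<iota> L R (f, h, k, g) =
    (THE u. u \<in> hom C (J_obj C \<iota> L f) (J_obj C \<iota> L g) \<and>
       u \<cdot>\<^bsub>C\<^esub> S_part C \<iota> L f = S_part C \<iota> L g \<cdot>\<^bsub>C\<^esub> on_arr M h \<and>
       T_part C \<iota> R g \<cdot>\<^bsub>C\<^esub> u = k \<cdot>\<^bsub>C\<^esub> T_part C \<iota> R f)"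

definition T_functor ::
    "('o, 'a) category \<Rightarrow> ('o, 'a, 'o, 'a) functor_data \<Rightarrow> ('o \<Rightarrow> 'a) \<Rightarrow> ('a \<Rightarrow> 'a) \<Rightarrow> ('a \<Rightarrow> 'a) \<Rightarrow>
      ('a, 'a square, 'a, 'a square) functor_data" where
  "T_functor C M \<iota> L R =
    \<lparr>on_obj = T_part C \<iota> R,
     on_arr = (\<lambda>(f, h, k, g). (T_part C \<iota> R f, J_arr C M \<iota> L R (f, h, k, g), k, T_part C \<iota> R g))\<rparr>"

definition nu_arr ::
    "('o, 'a) category \<Rightarrow> ('o \<Rightarrow> 'a) \<Rightarrow> ('a \<Rightarrow> 'a) \<Rightarrow> ('a \<Rightarrow> 'a) \<Rightarrow> 'a \<Rightarrow> 'a" where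
  "nu_arr C \<iota> L R f =
    (THE u. u \<in> hom C (J_obj C \<iota> L (T_part C \<iota> R f)) (J_obj C \<iota> L f) \<and>
       u \<cdot>\<^bsub>C\<^esub> S_part C \<iota> L (T_part C \<iota> R f) = \<iota> (J_obj C \<iota> L f) \<and>
       T_part C \<iota> R f \<cdot>\<^bsub>C\<^esub> u = T_part C \<iota> R (T_part C \<iota> R f))"

definition nu ::
    "('o, 'a) category \<Rightarrow> ('o \<Rightarrow> 'a) \<Rightarrow> ('a \<Rightarrow> 'a) \<Rightarrow> ('a \<Rightarrow> 'a) \<Rightarrow> 'a \<Rightarrow> 'a square" where
  "nu C \<iota> L R f =
    (T_part C \<iota> R (T_part C \<iota> R f), nu_arr C \<iota> L R f, Id C (Cod C f), T_part C \<iota> R f)"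

end

theory Submission
  imports Defs
begin

text \<open>Every equation between arrows out of some \<open>J_obj C \<iota> L f\<close> is checked by precomposing with
  \<open>S_part\<close> (in \<open>\<E>\<close>) and postcomposing with \<open>T_part\<close> (in \<open>\<M>\<close>), since diagonals are unique.
  For both naturality and associativity of \<open>\<nu>\<close>, the two composites agree after \<open>S_part\<close> by
  naturality of the counit \<open>\<iota>\<close>, and after \<open>T_part\<close> because \<open>\<nu>\<^sub>f\<close> lies over the identity.\<close>

section \<open>The arrow category\<close>

context category
begin

lemma in_hom_Dom_Cod: "f \<in> Arr C \<Longrightarrow> f \<in> hom C (Dom C f) (Cod C f)"
  by (simp add: hom_def)

text \<open>The quadruple encoding makes a hom-set determine the outer entries of its arrows. Goals
  about \<C>^2 thereby reduce to typing and one equation in the base category.\<close>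

lemma hom_arrow_category:
  "s \<in> hom (arrow_category C) f g \<longleftrightarrow>
    (\<exists>h k. s = (f, h, k, g) \<and> f \<in> Arr C \<and> g \<in> Arr C \<and>
      h \<in> hom C (Dom C f) (Dom C g) \<and> k \<in> hom C (Cod C f) (Cod C g) \<and> k \<cdot> f = g \<cdot> h)"
  by (cases s) (auto simp: hom_def arrow_category_def)

lemma arrow_category_Obj [simp]: "Obj (arrow_category C) = Arr C"
  by (simp add: arrow_category_def)

lemma arrow_category_Comp [simp]:
  "(f', h', k', g') \<cdot>\<^bsub>arrow_category C\<^esub> (f, h, k, g) = (f, h' \<cdot> h, k' \<cdot> k, g')"
  by (simp add: arrow_category_def)

lemma arrow_category_Id [simp]:
  "Id (arrow_category C) f = (f, Id C (Dom C f), Id C (Cod C f), f)"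
  by (simp add: arrow_category_def)

text \<open>Pasting of two commutative squares. It gives composition in the arrow category, and
  later both conditions that characterise \<open>J_arr\<close> on a composite.\<close>

lemma square_comp:
  assumes f: "f \<in> hom C A A'" and g: "g \<in> hom C B B'" and p: "p \<in> hom C D D'"
    and h: "h \<in> hom C A B" and k: "k \<in> hom C A' B'"
    and h': "h' \<in> hom C B D" and k': "k' \<in> hom C B' D'"
    and sq: "k \<cdot> f = g \<cdot> h" and sq': "k' \<cdot> g = p \<cdot> h'"
  shows "(k' \<cdot> k) \<cdot> f = p \<cdot> (h' \<cdot> h)"
proof -
  have "(k' \<cdot> k) \<cdot> f = k' \<cdot> (g \<cdot> h)"
    using Comp_assoc[OF f k k'] sq by simp
  also have "\<dots> = (p \<cdot> h') \<cdot> h"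
    using Comp_assoc[OF h g k'] sq' by simp
  also have "\<dots> = p \<cdot> (h' \<cdot> h)"
    by (rule Comp_assoc[OF h h' p])
  finally show ?thesis .
qed

lemma category_arrow_category: "category (arrow_category C)"
proof
  fix s assume "s \<in> Arr (arrow_category C)"
  then show "Dom (arrow_category C) s \<in> Obj (arrow_category C)"
    and "Cod (arrow_category C) s \<in> Obj (arrow_category C)"
    by (auto simp: arrow_category_def)
next
  fix f assume "f \<in> Obj (arrow_category C)"
  then show "Id (arrow_category C) f \<in> hom (arrow_category C) f f"
    using Comp_Id_left[OF in_hom_Dom_Cod] Comp_Id_right[OF in_hom_Dom_Cod]
    by (simp add: hom_arrow_category Id_in_hom Dom_in_Obj Cod_in_Obj)
next
  fix s t f g p
  assume "s \<in> hom (arrow_category C) f g" and "t \<in> hom (arrow_category C) g p"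
  then show "t \<cdot>\<^bsub>arrow_category C\<^esub> s \<in> hom (arrow_category C) f p"
    using square_comp[OF in_hom_Dom_Cod in_hom_Dom_Cod in_hom_Dom_Cod]
    by (fastforce simp: hom_arrow_category intro: Comp_in_hom)
next
  fix s t u f g p q
  assume "s \<in> hom (arrow_category C) f g" and "t \<in> hom (arrow_category C) g p"
    and "u \<in> hom (arrow_category C) p q"
  then show "(u \<cdot>\<^bsub>arrow_category C\<^esub> t) \<cdot>\<^bsub>arrow_category C\<^esub> s =
      u \<cdot>\<^bsub>arrow_category C\<^esub> (t \<cdot>\<^bsub>arrow_category C\<^esub> s)"
    by (auto simp: hom_arrow_category Comp_assoc)
next
  fix s f g
  assume "s \<in> hom (arrow_category C) f g"
  then show "Id (arrow_category C) g \<cdot>\<^bsub>arrow_category C\<^esub> s = s"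
    and "s \<cdot>\<^bsub>arrow_category C\<^esub> Id (arrow_category C) f = s"
    by (auto simp: hom_arrow_category Comp_Id_left Comp_Id_right)
qed

end

section \<open>Composite functors and uniqueness of diagonals\<close>

lemma category_functor_comp_functor:
  assumes "category_functor C D F" and "category_functor D E G"
  shows "category_functor C E (comp_functor G F)"
proof -
  interpret F: category_functor C D F by fact
  interpret G: category_functor D E G by fact
  show ?thesis
    by unfold_locales
      (simp_all add: comp_functor_def F.on_obj_in_Obj G.on_obj_in_Obj F.on_arr_in_hom
        G.on_arr_in_hom F.on_arr_Id G.on_arr_Id F.on_arr_Comp
        G.on_arr_Comp[OF F.on_arr_in_hom F.on_arr_in_hom])
qed

text \<open>Both \<open>u\<close> and \<open>v\<close> are diagonals of the one square with sides
  \<open>u \<cdot> e\<close> and \<open>m \<cdot> u\<close>, which commutes by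
  associativity.\<close>

lemma (in orthogonal_factorisation_system) diagonal_eqI:
  assumes e: "e \<in> \<E>" "e \<in> hom C X Y" and m: "m \<in> \<M>" "m \<in> hom C Z W"
    and u: "u \<in> hom C Y Z" and v: "v \<in> hom C Y Z"
    and "u \<cdot> e = v \<cdot> e" and "m \<cdot> u = m \<cdot> v"
  shows "u = v"
proof -
  have "\<exists>!h. h \<in> hom C (Cod C e) (Dom C m) \<and> h \<cdot> e = u \<cdot> e \<and> m \<cdot> h = m \<cdot> u"
  proof (rule unique_diagonal[OF e(1) m(1)])
    show "u \<cdot> e \<in> hom C (Dom C e) (Dom C m)" "m \<cdot> u \<in> hom C (Cod C e) (Cod C m)"
      using Comp_in_hom[OF e(2) u] Comp_in_hom[OF u m(2)] e(2) m(2) by (simp_all add: hom_def)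
    show "m \<cdot> (u \<cdot> e) = (m \<cdot> u) \<cdot> e"
      using Comp_assoc[OF e(2) u m(2)] by simp
  qed
  then show ?thesis
    using assms by (auto simp: hom_def)
qed

section \<open>Factorising an arrow precomposed with the counit\<close>

text \<open>An endofunctor with a natural transformation to the identity is called copointed;
  \<open>(M, \<iota>)\<close> enters in this form.\<close>

locale factorised_copointed_category =
  orthogonal_factorisation_system C \<E> \<M> +
  counit: natural_transformation C C M id_functor \<iota>
  for C :: "('o, 'a) category" (structure) and \<E> \<M> M \<iota> +
  fixes L R :: "'a \<Rightarrow> 'a"
  assumes chosen: "chosen_factorisations C \<E> \<M> L R"
begin

abbreviation S where "S \<equiv> S_part C \<iota> L"
abbreviation T where "T \<equiv> T_part C \<iota> R"
abbreviation J where "J \<equiv> J_obj C \<iota> L"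
abbreviation JJ where "JJ f h k g \<equiv> J_arr C M \<iota> L R (f, h, k, g)"
abbreviation \<nu> where "\<nu> \<equiv> nu_arr C \<iota> L R"

lemma counit_in_hom: "A \<in> Obj C \<Longrightarrow> \<iota> A \<in> hom C (on_obj M A) A"
  using counit.component_in_hom by (simp add: id_functor_def)

lemma counit_natural: "f \<in> hom C A B \<Longrightarrow> \<iota> B \<cdot> on_arr M f = f \<cdot> \<iota> A"
  using counit.naturality by (simp add: id_functor_def)

lemma M_in_hom: "f \<in> hom C A B \<Longrightarrow> on_arr M f \<in> hom C (on_obj M A) (on_obj M B)"
  by (rule counit.F.on_arr_in_hom)

lemma
  assumes "f \<in> hom C A B"
  shows S_in_E: "S f \<in> \<E>" and T_in_M: "T f \<in> \<M>"
    and S_in_hom: "S f \<in> hom C (on_obj M A) (J f)"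
    and T_in_hom: "T f \<in> hom C (J f) B"
    and T_S: "T f \<cdot> S f = f \<cdot> \<iota> A"
proof -
  let ?g = "f \<cdot> \<iota> (Dom C f)"
  have f: "Dom C f = A" "A \<in> Obj C"
    using assms Dom_in_Obj by (auto simp: hom_def)
  have g: "?g \<in> hom C (on_obj M A) B"
    using Comp_in_hom[OF counit_in_hom assms] f by simp
  then have *: "L ?g \<in> \<E>" "R ?g \<in> \<M>" "Cod C (L ?g) = Dom C (R ?g)" "R ?g \<cdot> L ?g = ?g"
    using chosen by (auto simp: chosen_factorisations_def hom_def)
  have "L ?g \<in> hom C (Dom C (L ?g)) (J f)" "R ?g \<in> hom C (J f) (Cod C (R ?g))"
    using * E_subset M_subset by (auto simp: hom_def J_obj_def S_part_def)
  \<comment> \<open>The choice of factors fixes only their common middle object. Their outer ends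
    are read off from the composite, which is \<open>?g\<close>.\<close>
  moreover from Comp_in_hom[OF this]
  have "Dom C (L ?g) = on_obj M A" "Cod C (R ?g) = B"
    using g * by (simp_all add: hom_def)
  ultimately show "S f \<in> \<E>" "T f \<in> \<M>" "S f \<in> hom C (on_obj M A) (J f)" "T f \<in> hom C (J f) B"
    "T f \<cdot> S f = f \<cdot> \<iota> A"
    using * f by (simp_all add: S_part_def T_part_def)
qed

lemma J_in_Obj: "f \<in> hom C A B \<Longrightarrow> J f \<in> Obj C"
  using T_in_hom[of f A B] Dom_in_Obj[of "T f"] by (simp add: hom_def)

section \<open>Lifting against chosen factors and functoriality of J\<close>

text \<open>Orthogonality of \<open>S f\<close> in \<E> to \<open>T g\<close> in \<M>; both definite
  descriptions, in \<open>J_arr\<close> and in \<open>nu_arr\<close>, rest on it.\<close>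

lemma diagonal:
  assumes f: "f \<in> hom C A B" and g: "g \<in> hom C A' B'"
    and x: "x \<in> hom C (on_obj M A) (J g)" and y: "y \<in> hom C (J f) B'"
    and "T g \<cdot> x = y \<cdot> S f"
  shows "\<exists>!u. u \<in> hom C (J f) (J g) \<and> u \<cdot> S f = x \<and> T g \<cdot> u = y"
  using unique_diagonal[OF S_in_E[OF f] T_in_M[OF g]] S_in_hom[OF f] T_in_hom[OF g] assms
  by (simp add: hom_def)

lemma diagonal_unique:
  assumes "f \<in> hom C A B" and "g \<in> hom C A' B'"
    and "u \<in> hom C (J f) (J g)" and "v \<in> hom C (J f) (J g)"
    and "u \<cdot> S f = v \<cdot> S f" and "T g \<cdot> u = T g \<cdot> v"
  shows "u = v"
  using diagonal_eqI S_in_E S_in_hom T_in_M T_in_hom assms by metis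

text \<open>The square to be filled commutes because both of its composites equal
  \<open>g \<cdot> h \<cdot> \<iota> A\<close>: one by naturality of \<iota> at \<open>h\<close>,
  the other by the given square. So the definite description denotes an arrow, and that arrow has
  the defining properties.\<close>

lemma
  assumes f: "f \<in> hom C A B" and g: "g \<in> hom C A' B'"
    and h: "h \<in> hom C A A'" and k: "k \<in> hom C B B'" and sq: "k \<cdot> f = g \<cdot> h"
  shows JJ_in_hom: "JJ f h k g \<in> hom C (J f) (J g)"
    and JJ_S: "JJ f h k g \<cdot> S f = S g \<cdot> on_arr M h"
    and T_JJ: "T g \<cdot> JJ f h k g = k \<cdot> T f"
proof -
  have A: "A \<in> Obj C" "A' \<in> Obj C"
    using h Dom_in_Obj Cod_in_Obj by (auto simp: hom_def)
  note Mh = M_in_hom[OF h] and \<iota> = counit_in_hom[OF A(1)] counit_in_hom[OF A(2)]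
  have "T g \<cdot> (S g \<cdot> on_arr M h) = (g \<cdot> \<iota> A') \<cdot> on_arr M h"
    using Comp_assoc[OF Mh S_in_hom[OF g] T_in_hom[OF g]] T_S[OF g] by simp
  also have "\<dots> = g \<cdot> (h \<cdot> \<iota> A)"
    using Comp_assoc[OF Mh \<iota>(2) g] counit_natural[OF h] by simp
  also have "\<dots> = (k \<cdot> f) \<cdot> \<iota> A"
    using Comp_assoc[OF \<iota>(1) h g] sq by simp
  also have "\<dots> = k \<cdot> (T f \<cdot> S f)"
    using Comp_assoc[OF \<iota>(1) f k] T_S[OF f] by simp
  also have "\<dots> = (k \<cdot> T f) \<cdot> S f"
    using Comp_assoc[OF S_in_hom[OF f] T_in_hom[OF f] k] by simp
  finally have "\<exists>!u. u \<in> hom C (J f) (J g) \<and> u \<cdot> S f = S g \<cdot> on_arr M h \<and> T g \<cdot> u = k \<cdot> T f"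
    by (intro diagonal[OF f g] Comp_in_hom[OF Mh S_in_hom[OF g]] Comp_in_hom[OF T_in_hom[OF f] k])
  from theI'[OF this]
  show "JJ f h k g \<in> hom C (J f) (J g)" "JJ f h k g \<cdot> S f = S g \<cdot> on_arr M h"
    "T g \<cdot> JJ f h k g = k \<cdot> T f"
    by simp_all
qed

lemma JJ_eqI:
  assumes "f \<in> hom C A B" and "g \<in> hom C A' B'"
    and "h \<in> hom C A A'" and "k \<in> hom C B B'" and "k \<cdot> f = g \<cdot> h"
    and "u \<in> hom C (J f) (J g)" and "u \<cdot> S f = S g \<cdot> on_arr M h" and "T g \<cdot> u = k \<cdot> T f"
  shows "JJ f h k g = u"
  using diagonal_unique[OF assms(1,2) JJ_in_hom[OF assms(1-5)] assms(6)]
    JJ_S[OF assms(1-5)] T_JJ[OF assms(1-5)] assms(7,8) by simp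

text \<open>The identity solves the two defining equations, since \<open>M\<close> preserves
  identities.\<close>

lemma JJ_Id:
  assumes f: "f \<in> hom C A B"
  shows "JJ f (Id C A) (Id C B) f = Id C (J f)"
proof -
  have A: "A \<in> Obj C" "B \<in> Obj C"
    using f Dom_in_Obj Cod_in_Obj by (auto simp: hom_def)
  show ?thesis
    using A f J_in_Obj[OF f] S_in_hom[OF f] T_in_hom[OF f]
    by (intro JJ_eqI[OF f f])
      (simp_all add: Id_in_hom Comp_Id_left Comp_Id_right counit.F.on_arr_Id)
qed

text \<open>A composite of diagonals is a diagonal of the pasted square, hence the one that
  \<open>J_arr\<close> selects there.\<close>

lemma JJ_Comp:
  assumes f: "f \<in> hom C A A'" and g: "g \<in> hom C B B'" and p: "p \<in> hom C D D'"
    and h: "h \<in> hom C A B" and k: "k \<in> hom C A' B'"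
    and h': "h' \<in> hom C B D" and k': "k' \<in> hom C B' D'"
    and sq: "k \<cdot> f = g \<cdot> h" and sq': "k' \<cdot> g = p \<cdot> h'"
  shows "JJ f (h' \<cdot> h) (k' \<cdot> k) p = JJ g h' k' p \<cdot> JJ f h k g"
proof (rule JJ_eqI[OF f p])
  note u = JJ_in_hom[OF f g h k sq] and v = JJ_in_hom[OF g p h' k' sq']
  show "h' \<cdot> h \<in> hom C A D" "k' \<cdot> k \<in> hom C A' D'"
    "JJ g h' k' p \<cdot> JJ f h k g \<in> hom C (J f) (J p)"
    by (fact Comp_in_hom[OF h h'] Comp_in_hom[OF k k'] Comp_in_hom[OF u v])+
  show "(k' \<cdot> k) \<cdot> f = p \<cdot> (h' \<cdot> h)"
    by (rule square_comp[OF f g p h k h' k' sq sq'])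
  \<comment> \<open>Pasting along \<open>S g\<close>: the squares run from \<open>S f\<close> to
    \<open>S g\<close> to \<open>S p\<close>, and \<open>M\<close> preserves the composite
    \<open>h' \<cdot> h\<close>.\<close>
  show "(JJ g h' k' p \<cdot> JJ f h k g) \<cdot> S f = S p \<cdot> on_arr M (h' \<cdot> h)"
    using square_comp[OF S_in_hom[OF f] S_in_hom[OF g] S_in_hom[OF p] M_in_hom[OF h] u M_in_hom[OF h'] v
        JJ_S[OF f g h k sq] JJ_S[OF g p h' k' sq']] counit.F.on_arr_Comp[OF h h'] by simp
  \<comment> \<open>The same pasting along \<open>T g\<close>, where the diagonals now form the
    domain side of the squares.\<close>
  show "T p \<cdot> (JJ g h' k' p \<cdot> JJ f h k g) = (k' \<cdot> k) \<cdot> T f"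
    using square_comp[OF T_in_hom[OF f] T_in_hom[OF g] T_in_hom[OF p] u k v k'
        T_JJ[OF f g h k sq, symmetric] T_JJ[OF g p h' k' sq', symmetric]] by simp
qed

section \<open>The multiplication, its naturality and associativity\<close>

text \<open>The square that defines \<open>\<nu> f\<close> commutes because it is the chosen
  factorisation of \<open>T f \<cdot> \<iota> (J f)\<close>, that is, \<open>T_S\<close> at
  \<open>T f\<close>.\<close>

lemma
  assumes f: "f \<in> hom C A B"
  shows nu_in_hom: "\<nu> f \<in> hom C (J (T f)) (J f)"
    and nu_S: "\<nu> f \<cdot> S (T f) = \<iota> (J f)"
    and T_nu: "T f \<cdot> \<nu> f = T (T f)"
proof -
  note Tf = T_in_hom[OF f]
  have "\<exists>!u. u \<in> hom C (J (T f)) (J f) \<and> u \<cdot> S (T f) = \<iota> (J f) \<and> T f \<cdot> u = T (T f)"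
    using diagonal[OF Tf f counit_in_hom[OF J_in_Obj[OF f]] T_in_hom[OF Tf]] T_S[OF Tf] by simp
  from theI'[OF this]
  show "\<nu> f \<in> hom C (J (T f)) (J f)" "\<nu> f \<cdot> S (T f) = \<iota> (J f)" "T f \<cdot> \<nu> f = T (T f)"
    by (simp_all add: nu_arr_def)
qed

text \<open>The arrow \<open>?v\<close> is the domain part of \<open>T\<close> applied twice to the
  square. Both sides become \<open>?u \<cdot> \<iota> (J f)\<close> after \<open>S (T f)\<close>,
  and \<open>k \<cdot> T (T f)\<close> when followed by \<open>T g\<close>.\<close>

lemma nu_natural:
  assumes f: "f \<in> hom C A B" and g: "g \<in> hom C A' B'"
    and h: "h \<in> hom C A A'" and k: "k \<in> hom C B B'" and sq: "k \<cdot> f = g \<cdot> h"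
  shows "\<nu> g \<cdot> JJ (T f) (JJ f h k g) k (T g) = JJ f h k g \<cdot> \<nu> f"
    (is "_ \<cdot> ?v = ?u \<cdot> _")
proof (rule diagonal_unique[OF T_in_hom[OF f] g])
  note Tf = T_in_hom[OF f] and Tg = T_in_hom[OF g]
  note u = JJ_in_hom[OF f g h k sq] and Tu = T_JJ[OF f g h k sq]
  note v = JJ_in_hom[OF Tf Tg u k Tu[symmetric]]
  note nf = nu_in_hom[OF f] and ng = nu_in_hom[OF g]
  show "\<nu> g \<cdot> ?v \<in> hom C (J (T f)) (J g)" "?u \<cdot> \<nu> f \<in> hom C (J (T f)) (J g)"
    by (fact Comp_in_hom[OF v ng] Comp_in_hom[OF nf u])+
  have "(\<nu> g \<cdot> ?v) \<cdot> S (T f) = (\<nu> g \<cdot> S (T g)) \<cdot> on_arr M ?u"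
    using Comp_assoc[OF S_in_hom[OF Tf] v ng] Comp_assoc[OF M_in_hom[OF u] S_in_hom[OF Tg] ng]
      JJ_S[OF Tf Tg u k Tu[symmetric]] by simp
  also have "\<dots> = ?u \<cdot> (\<nu> f \<cdot> S (T f))"
    using nu_S[OF f] nu_S[OF g] counit_natural[OF u] by simp
  also have "\<dots> = (?u \<cdot> \<nu> f) \<cdot> S (T f)"
    using Comp_assoc[OF S_in_hom[OF Tf] nf u] by simp
  finally show "(\<nu> g \<cdot> ?v) \<cdot> S (T f) = (?u \<cdot> \<nu> f) \<cdot> S (T f)" .
  have "T g \<cdot> (\<nu> g \<cdot> ?v) = k \<cdot> T (T f)"
    using Comp_assoc[OF v ng Tg] T_nu[OF g] T_JJ[OF Tf Tg u k Tu[symmetric]] by simp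
  also have "\<dots> = (k \<cdot> T f) \<cdot> \<nu> f"
    using Comp_assoc[OF nf Tf k] T_nu[OF f] by simp
  also have "\<dots> = T g \<cdot> (?u \<cdot> \<nu> f)"
    using Comp_assoc[OF nf u Tg] Tu by simp
  finally show "T g \<cdot> (\<nu> g \<cdot> ?v) = T g \<cdot> (?u \<cdot> \<nu> f)" .
qed

text \<open>This makes the component of \<nu> at \<open>f\<close> an arrow of the arrow category, so
  that \<open>T\<close> can be applied to it.\<close>

lemma nu_square:
  assumes "f \<in> hom C A B"
  shows "Id C B \<cdot> T (T f) = T f \<cdot> \<nu> f"
  using T_nu Comp_Id_left T_in_hom assms by metis

text \<open>The arrow \<open>?v\<close> is the domain part of \<open>T\<close> applied to the
  component of \<nu> at \<open>f\<close>. Followed by \<open>T f\<close>, both sides give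
  \<open>T (T (T f))\<close>.\<close>

lemma nu_associative:
  assumes f: "f \<in> hom C A B"
  shows "\<nu> f \<cdot> JJ (T (T f)) (\<nu> f) (Id C B) (T f) = \<nu> f \<cdot> \<nu> (T f)"
    (is "_ \<cdot> ?v = _")
proof (rule diagonal_unique[OF T_in_hom[OF T_in_hom[OF f]] f])
  note Tf = T_in_hom[OF f]
  note TTf = T_in_hom[OF Tf]
  note nf = nu_in_hom[OF f] and nTf = nu_in_hom[OF Tf]
  have B: "Id C B \<in> hom C B B"
    using f Cod_in_Obj Id_in_hom by (auto simp: hom_def)
  note v = JJ_in_hom[OF TTf Tf nf B nu_square[OF f]]
  show "\<nu> f \<cdot> ?v \<in> hom C (J (T (T f))) (J f)" "\<nu> f \<cdot> \<nu> (T f) \<in> hom C (J (T (T f))) (J f)"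
    by (fact Comp_in_hom[OF v nf] Comp_in_hom[OF nTf nf])+
  have "(\<nu> f \<cdot> ?v) \<cdot> S (T (T f)) = (\<nu> f \<cdot> S (T f)) \<cdot> on_arr M (\<nu> f)"
    using Comp_assoc[OF S_in_hom[OF TTf] v nf] Comp_assoc[OF M_in_hom[OF nf] S_in_hom[OF Tf] nf]
      JJ_S[OF TTf Tf nf B nu_square[OF f]] by simp
  \<comment> \<open>Naturality of \<iota> at the arrow \<open>\<nu> f\<close> itself: both
    expressions equal \<open>\<nu> f \<cdot> \<iota> (J (T f))\<close>.\<close>
  also have "\<dots> = \<nu> f \<cdot> (\<nu> (T f) \<cdot> S (T (T f)))"
    using nu_S[OF f] nu_S[OF Tf] counit_natural[OF nf] by simp
  also have "\<dots> = (\<nu> f \<cdot> \<nu> (T f)) \<cdot> S (T (T f))"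
    using Comp_assoc[OF S_in_hom[OF TTf] nTf nf] by simp
  finally show "(\<nu> f \<cdot> ?v) \<cdot> S (T (T f)) = (\<nu> f \<cdot> \<nu> (T f)) \<cdot> S (T (T f))" .
  have "T f \<cdot> (\<nu> f \<cdot> ?v) = T (T (T f))"
    using Comp_assoc[OF v nf Tf] T_nu[OF f] T_JJ[OF TTf Tf nf B nu_square[OF f]]
      Comp_Id_left[OF T_in_hom[OF TTf]] by simp
  also have "\<dots> = T f \<cdot> (\<nu> f \<cdot> \<nu> (T f))"
    using Comp_assoc[OF nTf nf Tf] T_nu[OF f] T_nu[OF Tf] by simp
  finally show "T f \<cdot> (\<nu> f \<cdot> ?v) = T f \<cdot> (\<nu> f \<cdot> \<nu> (T f))" .
qed

section \<open>Assembly of the semi-monad on the arrow category\<close>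

lemma T_Dom_Cod:
  assumes "f \<in> Arr C"
  shows "T f \<in> Arr C" and "Dom C (T f) = J f" and "Cod C (T f) = Cod C f"
  using T_in_hom[OF in_hom_Dom_Cod[OF assms]] by (simp_all add: hom_def)

lemma T_functor_on_obj [simp]: "on_obj (T_functor C M \<iota> L R) = T"
  by (simp add: T_functor_def)

lemma T_functor_on_arr [simp]:
  "on_arr (T_functor C M \<iota> L R) (f, h, k, g) = (T f, JJ f h k g, k, T g)"
  by (simp add: T_functor_def)

text \<open>The codomain component of a square passes through \<open>T\<close> unchanged, so the
  functor laws concern only the domain component, where they are \<open>JJ_Id\<close> and
  \<open>JJ_Comp\<close>.\<close>

lemma category_functor_T_functor:
  "category_functor (arrow_category C) (arrow_category C) (T_functor C M \<iota> L R)"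
proof (intro category_functor.intro category_functor_axioms.intro category_arrow_category)
  fix f assume f: "f \<in> Obj (arrow_category C)"
  then show "on_obj (T_functor C M \<iota> L R) f \<in> Obj (arrow_category C)"
    by (simp add: T_Dom_Cod)
  from f show "on_arr (T_functor C M \<iota> L R) (Id (arrow_category C) f) =
      Id (arrow_category C) (on_obj (T_functor C M \<iota> L R) f)"
    by (simp add: T_Dom_Cod JJ_Id[OF in_hom_Dom_Cod] del: J_arr.simps)
next
  fix s f g assume "s \<in> hom (arrow_category C) f g"
  then show "on_arr (T_functor C M \<iota> L R) s \<in>
      hom (arrow_category C) (on_obj (T_functor C M \<iota> L R) f) (on_obj (T_functor C M \<iota> L R) g)"
    using JJ_in_hom[OF in_hom_Dom_Cod in_hom_Dom_Cod] T_JJ[OF in_hom_Dom_Cod in_hom_Dom_Cod]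
    by (auto simp: hom_arrow_category T_Dom_Cod simp del: J_arr.simps)
next
  fix s t f g p
  assume "s \<in> hom (arrow_category C) f g" and "t \<in> hom (arrow_category C) g p"
  then show "on_arr (T_functor C M \<iota> L R) (t \<cdot>\<^bsub>arrow_category C\<^esub> s) =
      on_arr (T_functor C M \<iota> L R) t \<cdot>\<^bsub>arrow_category C\<^esub> on_arr (T_functor C M \<iota> L R) s"
    using JJ_Comp[OF in_hom_Dom_Cod in_hom_Dom_Cod in_hom_Dom_Cod]
    by (auto simp: hom_arrow_category simp del: J_arr.simps)
qed

text \<open>On domain components the laws are \<open>nu_natural\<close> and
  \<open>nu_associative\<close>. On codomain components they involve only identities and
  \<open>k\<close>, and the identities match because \<open>T f\<close> has the same codomain as
  \<open>f\<close>.\<close>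

lemma semi_monad_T_functor:
  "semi_monad (arrow_category C) (T_functor C M \<iota> L R) (nu C \<iota> L R)"
proof (intro semi_monad.intro natural_transformation.intro natural_transformation_axioms.intro
    semi_monad_axioms.intro category_functor_T_functor
    category_functor_comp_functor[OF category_functor_T_functor category_functor_T_functor])
  fix f assume "f \<in> Obj (arrow_category C)"
  then have f: "f \<in> Arr C" by simp
  note f' = in_hom_Dom_Cod[OF f]
  show "nu C \<iota> L R f \<in> hom (arrow_category C)
      (on_obj (comp_functor (T_functor C M \<iota> L R) (T_functor C M \<iota> L R)) f)
      (on_obj (T_functor C M \<iota> L R) f)"
    using f nu_in_hom[OF f'] nu_square[OF f']
    by (simp add: hom_arrow_category comp_functor_def nu_def T_Dom_Cod Id_in_hom Cod_in_Obj)
  show "nu C \<iota> L R f \<cdot>\<^bsub>arrow_category C\<^esub> on_arr (T_functor C M \<iota> L R) (nu C \<iota> L R f) =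
      nu C \<iota> L R f \<cdot>\<^bsub>arrow_category C\<^esub> nu C \<iota> L R (on_obj (T_functor C M \<iota> L R) f)"
    using f nu_associative[OF f'] by (simp add: nu_def T_Dom_Cod del: J_arr.simps)
next
  fix s f g assume "s \<in> hom (arrow_category C) f g"
  then show "nu C \<iota> L R g \<cdot>\<^bsub>arrow_category C\<^esub>
        on_arr (comp_functor (T_functor C M \<iota> L R) (T_functor C M \<iota> L R)) s =
      on_arr (T_functor C M \<iota> L R) s \<cdot>\<^bsub>arrow_category C\<^esub> nu C \<iota> L R f"
    using nu_natural[OF in_hom_Dom_Cod in_hom_Dom_Cod]
    by (auto simp: hom_arrow_category comp_functor_def nu_def Comp_Id_left Comp_Id_right
        simp del: J_arr.simps)
qed

end

theorem proposition13:
  fixes C :: "('o, 'a) category"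
    and \<E> \<M> :: "'a set"
    and L R :: "'a \<Rightarrow> 'a"
    and M :: "('o, 'a, 'o, 'a) functor_data"
    and \<iota> :: "'o \<Rightarrow> 'a"
  assumes "category C"
    and "orthogonal_factorisation_system C \<E> \<M>"
    and "chosen_factorisations C \<E> \<M> L R"
    and "idempotent_comonad C M \<iota>"
  shows "semi_monad (arrow_category C) (T_functor C M \<iota> L R) (nu C \<iota> L R)"
proof -
  \<comment> \<open>Unpacking the comonad exposes its counit as a natural transformation to the
    identity, as the locale takes it.\<close>
  obtain \<delta> where "comonad C M \<iota> \<delta>"
    using assms(4) by (auto simp: idempotent_comonad_def)
  then have "natural_transformation C C M id_functor \<iota>"
    by (rule comonad.axioms)
  then show ?thesis
    using assms(2,3) factorised_copointed_category.semi_monad_T_functor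
      factorised_copointed_category.intro factorised_copointed_category_axioms.intro by metis
qed

end
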